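(* Let $\mathcal{H}(\Omega)$ and $\mathcal{K}(Q)$ be reproducing kernel Hilbert spaces on sets $\Omega$ and $Q$, let $A\in\mathcal{B}(\mathcal{H}(\Omega))$ be a positive self-adjoint operator, let $\Phi:\mathcal{B}(\mathcal{H}(\Omega))\to\mathcal{B}(\mathcal{K}(Q))$ be a normalized positive linear map, and let $f:[0,\infty)\to\mathbb{R}$ be a continuous superquadratic function. Suppose that $f$ is nonnegative and that $$f\big(\widetilde{\Phi(A)}(\mu)\big)\ \ge\ \widetilde{\Phi(f(A))}(\mu)\qquad\text{for all }\mu\in Q.$$ Then $f$ is convex and $$f\big(\mathrm{Ber}(\Phi(A))\big)=\mathrm{Ber}\big(\Phi(f(A))\big).$$
   Context: A function $f:[0,\infty)\to\mathbb{R}$ is superquadratic if for every $x\ge0$ there is a constant $C_x\in\mathbb{R}$ such that $f(y)\ge f(x)+C_x(y-x)+f(|y-x|)$ for all $y\ge0$. $\mathcal{B}(\mathcal{H})$ denotes the bounded linear operators on a (complex) Hilbert space $\mathcal{H}$. For a reproducing kernel Hilbert space on a set $X$ with reproducing kernel $k_x$ at $x\in X$, $\hat{k}_x=k_x/\|k_x\|$ is the normalized reproducing kernel; for a bounded operator $T$, the Berezin transform is $\widetilde{T}(x)=\langle T\hat{k}_x,\hat{k}_x\rangle$ and the Berezin range (Berezin set) is $\mathrm{Ber}(T)=\{\widetilde{T}(x):x\in X\}$. A linear map $\Phi$ between operator algebras is positive if it maps positive operators to positive operators, and normalized (unital) if it maps the identity to the identity. $f(A)$ is defined by the continuous functional calculus.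 For a set $S\subseteq[0,\infty)$, $f(S)$ is the image of $S$ under $f$. *)

theory Defs
  imports "HOL-Analysis.Analysis" "HOL-Library.Nonpos_Ints" "HOL-Computational_Algebra.Polynomial"
begin

text \<open>The inner product is linear in its first argument, so that \<open>h x = cinner h k\<^sub>x\<close>
  for a reproducing kernel. Positive definiteness is part of \<open>cinner_self\<close>, since \<open>norm\<close> is
  already a norm in \<^class>\<open>real_normed_vector\<close>.\<close>

class complex_inner_space = real_normed_vector +
  fixes scaleC :: "complex \<Rightarrow> 'a \<Rightarrow> 'a" (infixr "*\<^sub>C" 75)
    and cinner :: "'a \<Rightarrow> 'a \<Rightarrow> complex"
  assumes scaleC_add_right: "c *\<^sub>C (x + y) = c *\<^sub>C x + c *\<^sub>C y"
    and scaleC_add_left: "(c + d) *\<^sub>C x = c *\<^sub>C x + d *\<^sub>C x"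
    and scaleC_scaleC: "c *\<^sub>C d *\<^sub>C x = (c * d) *\<^sub>C x"
    and scaleR_scaleC: "r *\<^sub>R x = complex_of_real r *\<^sub>C x"
    and cinner_commute: "cinner x y = cnj (cinner y x)"
    and cinner_add_left: "cinner (x + y) z = cinner x z + cinner y z"
    and cinner_scaleC_left: "cinner (c *\<^sub>C x) y = c * cinner x y"
    and cinner_self: "cinner x x = complex_of_real ((norm x)\<^sup>2)"

class complex_hilbert_space = complex_inner_space + complete_space

lemma norm_scaleC: "norm (c *\<^sub>C x) = cmod c * norm (x :: 'h :: complex_inner_space)"
proof -
  have "cinner (c *\<^sub>C x) (c *\<^sub>C x) = c * cnj (cinner (c *\<^sub>C x) x)"
    by (metis cinner_commute cinner_scaleC_left)
  also have "\<dots> = c * cnj c * cinner x x"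
    by (simp add: cinner_scaleC_left cinner_self)
  finally have "complex_of_real ((norm (c *\<^sub>C x))\<^sup>2)
      = complex_of_real ((cmod c)\<^sup>2) * complex_of_real ((norm x)\<^sup>2)"
    by (simp only: cinner_self complex_norm_square)
  then have "(norm (c *\<^sub>C x))\<^sup>2 = (cmod c * norm x)\<^sup>2"
    by (metis of_real_eq_iff of_real_mult power_mult_distrib)
  then show ?thesis
    by (simp add: power2_eq_iff_nonneg)
qed

text \<open>The library type of bounded operators consists of real-linear maps;
  \<open>bounded_ops\<close> is the set of bounded complex-linear operators on the whole space.\<close>

definition bounded_ops :: "('h::complex_hilbert_space \<Rightarrow>\<^sub>L 'h) set" where
  "bounded_ops = {T. \<forall>c x. blinfun_apply T (c *\<^sub>C x) = c *\<^sub>C blinfun_apply T x}"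

lift_definition op_scaleC ::
    "complex \<Rightarrow> ('h::complex_hilbert_space \<Rightarrow>\<^sub>L 'h) \<Rightarrow> ('h \<Rightarrow>\<^sub>L 'h)"
  is "\<lambda>c T x. c *\<^sub>C T x"
proof -
  fix c :: complex and T :: "'h \<Rightarrow> 'h"
  assume T: "bounded_linear T"
  have "bounded_linear (\<lambda>x::'h. c *\<^sub>C x)"
    by (rule bounded_linear_intro[where K = "cmod c"])
      (simp_all add: scaleC_add_right scaleR_scaleC scaleC_scaleC norm_scaleC mult.commute)
  from bounded_linear_compose[OF this T] show "bounded_linear (\<lambda>x. c *\<^sub>C T x)" .
qed

definition selfadjoint_op :: "('h::complex_hilbert_space \<Rightarrow>\<^sub>L 'h) \<Rightarrow> bool" where
  "selfadjoint_op T \<longleftrightarrow> T \<in> bounded_ops \<and>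
     (\<forall>x y. cinner (blinfun_apply T x) y = cinner x (blinfun_apply T y))"

definition positive_op :: "('h::complex_hilbert_space \<Rightarrow>\<^sub>L 'h) \<Rightarrow> bool" where
  "positive_op T \<longleftrightarrow> T \<in> bounded_ops \<and> (\<forall>x. cinner (blinfun_apply T x) x \<in> \<real>\<^sub>\<ge>\<^sub>0)"

text \<open>Only the values of \<open>\<Phi>\<close> on \<open>bounded_ops\<close> matter.\<close>

definition normalized_positive_linear_map ::
    "(('h::complex_hilbert_space \<Rightarrow>\<^sub>L 'h) \<Rightarrow> ('k::complex_hilbert_space \<Rightarrow>\<^sub>L 'k)) \<Rightarrow> bool" where
  "normalized_positive_linear_map \<Phi> \<longleftrightarrow>
     (\<forall>T\<in>bounded_ops. \<Phi> T \<in> bounded_ops) \<and>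
     (\<forall>S\<in>bounded_ops. \<forall>T\<in>bounded_ops. \<Phi> (S + T) = \<Phi> S + \<Phi> T) \<and>
     (\<forall>c. \<forall>T\<in>bounded_ops. \<Phi> (op_scaleC c T) = op_scaleC c (\<Phi> T)) \<and>
     (\<forall>T. positive_op T \<longrightarrow> positive_op (\<Phi> T)) \<and>
     \<Phi> id_blinfun = id_blinfun"

definition spectrum :: "('h::complex_hilbert_space \<Rightarrow>\<^sub>L 'h) \<Rightarrow> complex set" where
  "spectrum T = {z. \<not> (\<exists>S\<in>bounded_ops.
     S o\<^sub>L (T - op_scaleC z id_blinfun) = id_blinfun \<and>
     (T - op_scaleC z id_blinfun) o\<^sub>L S = id_blinfun)}"

definition poly_op :: "real poly \<Rightarrow> ('h::complex_hilbert_space \<Rightarrow>\<^sub>L 'h) \<Rightarrow> ('h \<Rightarrow>\<^sub>L 'h)" where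
  "poly_op p T = (\<Sum>i\<le>degree p. coeff p i *\<^sub>R (((o\<^sub>L) T) ^^ i) id_blinfun)"

text \<open>For self-adjoint \<open>T\<close> the spectrum is real, and for \<open>f\<close> continuous on it, \<open>f(T)\<close> is the limit
  in operator norm of \<open>p\<^sub>n(T)\<close> for real polynomials \<open>p\<^sub>n\<close> converging to \<open>f\<close>
  uniformly on the spectrum; it does not depend on the choice of \<open>p\<^sub>n\<close>.\<close>

definition cfc :: "(real \<Rightarrow> real) \<Rightarrow> ('h::complex_hilbert_space \<Rightarrow>\<^sub>L 'h) \<Rightarrow> ('h \<Rightarrow>\<^sub>L 'h)" where
  "cfc f T = (THE S. \<exists>p :: nat \<Rightarrow> real poly.
     uniform_limit {t. complex_of_real t \<in> spectrum T} (\<lambda>n. poly (p n)) f sequentially \<and>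
     (\<lambda>n. poly_op (p n) T) \<longlonglongrightarrow> S)"

text \<open>The type \<open>'h\<close> is a Hilbert space whose elements are functions on the set \<open>X\<close>:
  \<open>ev h x\<close> is the value of \<open>h\<close> at \<open>x\<close>, the vector space operations are pointwise, and
  \<open>h\<close> is determined by its values on \<open>X\<close>.\<close>

locale rkhs =
  fixes X :: "'a set" and ev :: "'h::complex_hilbert_space \<Rightarrow> 'a \<Rightarrow> complex"
  assumes ev_add: "x \<in> X \<Longrightarrow> ev (g + h) x = ev g x + ev h x"
    and ev_scaleC: "x \<in> X \<Longrightarrow> ev (c *\<^sub>C h) x = c * ev h x"
    and ev_inject: "(\<And>x. x \<in> X \<Longrightarrow> ev g x = ev h x) \<Longrightarrow> g = h"
    and ev_bounded: "x \<in> X \<Longrightarrow> \<exists>C. \<forall>h. cmod (ev h x) \<le> C * norm h"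

definition rep_kernel :: "('h::complex_hilbert_space \<Rightarrow> 'a \<Rightarrow> complex) \<Rightarrow> 'a \<Rightarrow> 'h" where
  "rep_kernel ev x = (THE k. \<forall>h. ev h x = cinner h k)"

text \<open>If the kernel vanishes at \<open>x\<close>, which the mathematical notion excludes, the following
  vector is \<open>0\<close>.\<close>

definition normalized_kernel :: "('h::complex_hilbert_space \<Rightarrow> 'a \<Rightarrow> complex) \<Rightarrow> 'a \<Rightarrow> 'h" where
  "normalized_kernel ev x = (1 / norm (rep_kernel ev x)) *\<^sub>R rep_kernel ev x"

definition berezin_transform ::
    "('h::complex_hilbert_space \<Rightarrow> 'a \<Rightarrow> complex) \<Rightarrow> ('h \<Rightarrow>\<^sub>L 'h) \<Rightarrow> 'a \<Rightarrow> complex" where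
  "berezin_transform ev T x =
     cinner (blinfun_apply T (normalized_kernel ev x)) (normalized_kernel ev x)"

definition berezin_range ::
    "'a set \<Rightarrow> ('h::complex_hilbert_space \<Rightarrow> 'a \<Rightarrow> complex) \<Rightarrow> ('h \<Rightarrow>\<^sub>L 'h) \<Rightarrow> complex set" where
  "berezin_range X ev T = {berezin_transform ev T x | x. x \<in> X}"

definition superquadratic :: "(real \<Rightarrow> real) \<Rightarrow> bool" where
  "superquadratic f \<longleftrightarrow>
     (\<forall>x\<ge>0. \<exists>C. \<forall>y\<ge>0. f y \<ge> f x + C * (y - x) + f \<bar>y - x\<bar>)"

end

theory Submission
  imports Defs "HOL-Computational_Algebra.Fundamental_Theorem_Algebra"
begin

text \<open>A nonnegative superquadratic function vanishes at \<open>0\<close> and has a supporting line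
  \<open>f t \<ge> f s + C * (t - s)\<close> at every \<open>s \<ge> 0\<close>, hence is convex. Taking \<open>s\<close> to be the Berezin transform of
  \<open>\<Phi> A\<close> at \<open>\<mu>\<close>, the functional calculus and the positivity of \<open>\<Phi>\<close> turn the supporting line into
  Jensen's inequality, which is the reverse of the assumed one. The functional calculus is under control
  once a real polynomial that is nonnegative on the spectrum of a self-adjoint \<open>T\<close> is known to give a positive
  operator \<open>p(T)\<close>: if the infimum \<open>m\<close> of the quadratic form of \<open>p(T)\<close> on the unit sphere were negative,
  then factoring \<open>p - m\<close> over the complex numbers would show that \<open>p(T) - m\<close> is bounded below, and
  the Cauchy-Schwarz inequality for its quadratic form would push the infimum above \<open>m\<close>.\<close>

section \<open>Complex inner product spaces\<close>

text \<open>Gives a complete space of bounded operators, in which the Neumann series and the limits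
  of polynomials of an operator exist.\<close>

instance complex_hilbert_space \<subseteq> banach ..

lemma bounded_bilinear_scaleC:
  "bounded_bilinear (scaleC :: complex \<Rightarrow> 'h :: complex_inner_space \<Rightarrow> 'h)"
proof
  show "\<exists>K. \<forall>c (x::'h). norm (c *\<^sub>C x) \<le> norm c * norm x * K"
    by (rule exI[of _ 1]) (simp add: norm_scaleC)
qed (simp_all add: scaleC_add_left scaleC_add_right scaleR_scaleC scaleC_scaleC scaleR_conv_of_real mult.commute)

interpretation scaleC: bounded_bilinear "scaleC :: complex \<Rightarrow> 'h :: complex_inner_space \<Rightarrow> 'h"
  by (rule bounded_bilinear_scaleC)

lemma cinner_add_right: "cinner x (y + z) = cinner x y + cinner x z"
  by (metis cinner_add_left cinner_commute complex_cnj_add)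

lemma cinner_scaleC_right: "cinner x (c *\<^sub>C y) = cnj c * cinner x y"
  by (metis cinner_commute cinner_scaleC_left complex_cnj_mult)

lemma cinner_scaleR_left: "cinner (r *\<^sub>R x) y = r *\<^sub>R cinner x y"
  by (simp add: scaleR_scaleC cinner_scaleC_left scaleR_conv_of_real)

lemma cinner_scaleR_right: "cinner x (r *\<^sub>R y) = r *\<^sub>R cinner x y"
  by (simp add: scaleR_scaleC cinner_scaleC_right scaleR_conv_of_real)

lemma psd_form_Cauchy_Schwarz:
  fixes b :: "'v::real_vector \<Rightarrow> 'v \<Rightarrow> real"
  assumes add: "\<And>x y z. b (x + y) z = b x z + b y z"
    and scaleR: "\<And>r x y. b (r *\<^sub>R x) y = r * b x y"
    and sym: "\<And>x y. b x y = b y x"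
    and nonneg: "\<And>x. 0 \<le> b x x"
  shows "(b x y)\<^sup>2 \<le> b x x * b y y"
proof -
  have quad: "0 \<le> b x x + 2 * r * b x y + r\<^sup>2 * b y y" for r
  proof -
    have "b (x + r *\<^sub>R y) (x + r *\<^sub>R y) = b x x + 2 * r * b x y + r\<^sup>2 * b y y"
      using sym[of x "x + r *\<^sub>R y"] sym[of y "x + r *\<^sub>R y"] sym[of y x]
      by (simp add: add scaleR power2_eq_square algebra_simps)
    then show ?thesis
      using nonneg by metis
  qed
  show ?thesis
  proof (cases "b y y = 0")
    case True
    have "b x y = 0"
    proof (rule ccontr)
      assume "b x y \<noteq> 0"
      \<comment> \<open>With \<open>b y y = 0\<close> the quadratic is affine in \<open>r\<close>,
        and this \<open>r\<close> gives it the value -1.\<close>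
      then show False
        using quad[of "- (b x x + 1) / (2 * b x y)"] True by (simp add: field_simps)
    qed
    then show ?thesis
      using nonneg by simp
  next
    case False
    then have pos: "0 < b y y"
      using nonneg[of y] by simp
    \<comment> \<open>The chosen \<open>r\<close> minimizes the quadratic.\<close>
    then show ?thesis
      using quad[of "- b x y / b y y"]
      by (simp add: power2_eq_square field_simps)
  qed
qed

lemma Re_cinner_commute: "Re (cinner x y) = Re (cinner y x)"
  using arg_cong[OF cinner_commute[of x y], of Re] by simp

lemma abs_Re_cinner_le: "\<bar>Re (cinner x y)\<bar> \<le> norm x * norm y"
proof -
  have "(Re (cinner x y))\<^sup>2 \<le> Re (cinner x x) * Re (cinner y y)"
    by (rule psd_form_Cauchy_Schwarz)
      (simp_all add: cinner_add_left cinner_scaleR_left Re_cinner_commute cinner_self)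
  also have "\<dots> = (norm x * norm y)\<^sup>2"
    by (simp add: cinner_self power_mult_distrib)
  finally show ?thesis
    by (metis abs_le_square_iff abs_mult abs_norm_cancel)
qed

text \<open>A unimodular factor on \<open>x\<close> turns the inner product into its modulus, which
  reduces the claim to the bound for real parts.\<close>

lemma cmod_cinner_le: "cmod (cinner x y) \<le> norm x * norm y"
proof (cases "cinner x y = 0")
  case False
  define c where "c = cnj (sgn (cinner x y))"
  have c: "cmod c = 1"
    using False by (simp add: c_def norm_sgn)
  have "cinner (c *\<^sub>C x) y = of_real (cmod (cinner x y))"
    using False
    by (simp add: c_def cinner_scaleC_left sgn_eq power2_eq_square
        flip: complex_norm_square[of "cinner x y"] mult.commute[of "cinner x y"])
  then have "cmod (cinner x y) = Re (cinner (c *\<^sub>C x) y)"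
    by simp
  also have "\<dots> \<le> norm (c *\<^sub>C x) * norm y"
    using abs_Re_cinner_le[of "c *\<^sub>C x" y] by simp
  finally show ?thesis
    by (simp add: norm_scaleC c)
qed simp

lemma bounded_bilinear_cinner:
  "bounded_bilinear (cinner :: 'h :: complex_inner_space \<Rightarrow> 'h \<Rightarrow> complex)"
proof
  show "\<exists>K. \<forall>(x::'h) y. norm (cinner x y) \<le> norm x * norm y * K"
    by (rule exI[of _ 1]) (simp add: cmod_cinner_le)
qed (simp_all add: cinner_add_left cinner_add_right cinner_scaleR_left cinner_scaleR_right)

interpretation cinner: bounded_bilinear "cinner :: 'h :: complex_inner_space \<Rightarrow> 'h \<Rightarrow> complex"
  by (rule bounded_bilinear_cinner)

section \<open>Bounded operators\<close>

interpretation blinfun_compose: bounded_bilinear "(o\<^sub>L)"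
  by (rule bounded_bilinear_blinfun_compose)

lemma blinfun_compose_id [simp]: "T o\<^sub>L id_blinfun = T" "id_blinfun o\<^sub>L T = T"
  by (simp_all add: blinfun_eqI)

lemma bounded_opsI:
  "(\<And>c x. blinfun_apply T (c *\<^sub>C x) = c *\<^sub>C blinfun_apply T x) \<Longrightarrow> T \<in> bounded_ops"
  by (simp add: bounded_ops_def)

lemma bounded_ops_scaleC:
  "T \<in> bounded_ops \<Longrightarrow> blinfun_apply T (c *\<^sub>C x) = c *\<^sub>C blinfun_apply T x"
  by (simp add: bounded_ops_def)

lemma scaleC_scaleR_commute: "r *\<^sub>R c *\<^sub>C x = c *\<^sub>C r *\<^sub>R (x :: 'h :: complex_inner_space)"
  by (simp add: scaleR_scaleC scaleC_scaleC mult.commute)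

lemma op_scaleC_of_real [simp]: "op_scaleC (complex_of_real r) T = r *\<^sub>R T"
  by (rule blinfun_eqI) (simp add: op_scaleC.rep_eq blinfun.scaleR_left scaleR_scaleC)

lemma bounded_ops_id [simp]: "id_blinfun \<in> bounded_ops"
  by (simp add: bounded_ops_def)

lemma bounded_ops_add: "S \<in> bounded_ops \<Longrightarrow> T \<in> bounded_ops \<Longrightarrow> S + T \<in> bounded_ops"
  by (simp add: bounded_ops_def blinfun.add_left scaleC_add_right)

lemma bounded_ops_scaleR: "T \<in> bounded_ops \<Longrightarrow> r *\<^sub>R T \<in> bounded_ops"
  by (simp add: bounded_ops_def blinfun.scaleR_left scaleC_scaleR_commute)

lemma bounded_ops_diff: "S \<in> bounded_ops \<Longrightarrow> T \<in> bounded_ops \<Longrightarrow> S - T \<in> bounded_ops"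
  by (simp add: bounded_ops_def blinfun.diff_left scaleC.diff_right)

lemma bounded_ops_sum: "(\<And>i. i \<in> I \<Longrightarrow> T i \<in> bounded_ops) \<Longrightarrow> sum T I \<in> bounded_ops"
  by (simp add: bounded_ops_def blinfun.sum_left scaleC.sum_right)

lemma bounded_ops_compose: "S \<in> bounded_ops \<Longrightarrow> T \<in> bounded_ops \<Longrightarrow> S o\<^sub>L T \<in> bounded_ops"
  by (simp add: bounded_ops_def)

lemma bounded_ops_funpow: "T \<in> bounded_ops \<Longrightarrow> (((o\<^sub>L) T) ^^ i) id_blinfun \<in> bounded_ops"
  by (induction i) (simp_all add: bounded_ops_compose)

lemma bounded_ops_limit:
  assumes "\<And>n. T n \<in> bounded_ops" and "T \<longlonglongrightarrow> S"
  shows "S \<in> bounded_ops"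
proof (rule bounded_opsI)
  fix c x
  have "(\<lambda>n. T n (c *\<^sub>C x)) \<longlonglongrightarrow> S (c *\<^sub>C x)"
    by (intro blinfun.tendsto assms tendsto_const)
  moreover have "(\<lambda>n. c *\<^sub>C T n x) \<longlonglongrightarrow> c *\<^sub>C S x"
    by (intro blinfun.tendsto scaleC.tendsto assms tendsto_const)
  ultimately show "S (c *\<^sub>C x) = c *\<^sub>C S x"
    using assms(1) by (simp add: bounded_ops_scaleC LIMSEQ_unique)
qed

section \<open>Self-adjoint and positive operators\<close>

lemma selfadjoint_op_bounded: "selfadjoint_op T \<Longrightarrow> T \<in> bounded_ops"
  by (simp add: selfadjoint_op_def)

lemma selfadjoint_opD: "selfadjoint_op T \<Longrightarrow> cinner (blinfun_apply T x) y = cinner x (blinfun_apply T y)"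
  by (simp add: selfadjoint_op_def)

lemma selfadjoint_op_id: "selfadjoint_op id_blinfun"
  by (simp add: selfadjoint_op_def)

lemma selfadjoint_op_add: "selfadjoint_op S \<Longrightarrow> selfadjoint_op T \<Longrightarrow> selfadjoint_op (S + T)"
  by (simp add: selfadjoint_op_def bounded_ops_add blinfun.add_left cinner_add_left cinner_add_right)

lemma selfadjoint_op_diff: "selfadjoint_op S \<Longrightarrow> selfadjoint_op T \<Longrightarrow> selfadjoint_op (S - T)"
  by (simp add: selfadjoint_op_def bounded_ops_diff blinfun.diff_left cinner.diff_left cinner.diff_right)

lemma selfadjoint_op_scaleR: "selfadjoint_op T \<Longrightarrow> selfadjoint_op (r *\<^sub>R T)"
  by (simp add: selfadjoint_op_def bounded_ops_scaleR blinfun.scaleR_left cinner_scaleR_left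
      cinner_scaleR_right)

lemma selfadjoint_op_sum: "(\<And>i. i \<in> I \<Longrightarrow> selfadjoint_op (T i)) \<Longrightarrow> selfadjoint_op (sum T I)"
  by (simp add: selfadjoint_op_def bounded_ops_sum blinfun.sum_left cinner.sum_left cinner.sum_right)

lemma selfadjoint_op_limit:
  assumes "\<And>n. selfadjoint_op (T n)" and "T \<longlonglongrightarrow> S"
  shows "selfadjoint_op S"
  unfolding selfadjoint_op_def
proof (intro conjI allI)
  show "S \<in> bounded_ops"
    using assms by (blast intro: bounded_ops_limit selfadjoint_op_bounded)
  fix x y
  have "(\<lambda>n. cinner (T n x) y) \<longlonglongrightarrow> cinner (S x) y"
    by (intro blinfun.tendsto cinner.tendsto assms tendsto_const)
  moreover have "(\<lambda>n. cinner x (T n y)) \<longlonglongrightarrow> cinner x (S y)"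
    by (intro blinfun.tendsto cinner.tendsto assms tendsto_const)
  ultimately show "cinner (S x) y = cinner x (S y)"
    using assms(1) by (simp add: selfadjoint_opD LIMSEQ_unique)
qed

lemma funpow_compose_apply:
  fixes T :: "'h::real_normed_vector \<Rightarrow>\<^sub>L 'h"
  shows "blinfun_apply ((((o\<^sub>L) T) ^^ i) id_blinfun) x = (blinfun_apply T ^^ i) x"
  by (induction i) simp_all

lemma selfadjoint_op_funpow:
  assumes "selfadjoint_op T"
  shows "selfadjoint_op ((((o\<^sub>L) T) ^^ i) id_blinfun)"
proof -
  have "cinner ((blinfun_apply T ^^ i) x) y = cinner x ((blinfun_apply T ^^ i) y)" for x y
    by (induction i arbitrary: x y)
      (simp_all add: selfadjoint_opD[OF assms] funpow_swap1)
  then show ?thesis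
    using assms by (simp add: selfadjoint_op_def bounded_ops_funpow funpow_compose_apply)
qed

lemma selfadjoint_op_Im: "selfadjoint_op T \<Longrightarrow> Im (cinner (blinfun_apply T x) x) = 0"
  by (metis Reals_cnj_iff cinner_commute complex_is_Real_iff selfadjoint_opD)

lemma positive_op_iff:
  assumes "selfadjoint_op T"
  shows "positive_op T \<longleftrightarrow> (\<forall>x. 0 \<le> Re (cinner (blinfun_apply T x) x))"
  using assms
  by (auto simp: positive_op_def selfadjoint_op_bounded complex_nonneg_Reals_iff selfadjoint_op_Im)

lemma Re_cinner_apply_le: "\<bar>Re (cinner (blinfun_apply T x) x)\<bar> \<le> norm T * (norm x)\<^sup>2"
proof -
  have "\<bar>Re (cinner (T x) x)\<bar> \<le> norm (T x) * norm x"
    by (rule abs_Re_cinner_le)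
  also have "\<dots> \<le> norm T * norm x * norm x"
    by (intro mult_right_mono norm_blinfun norm_ge_zero)
  finally show ?thesis
    by (simp add: power2_eq_square mult.assoc)
qed

text \<open>Cauchy-Schwarz for the form \<open>Re (cinner (T u) v)\<close> at \<open>u = x\<close>,
  \<open>v = T x\<close>, after which the square of \<open>norm (T x)\<close> cancels. It converts a
  lower bound on \<open>norm (T x)\<close> into one on the quadratic form.\<close>

lemma positive_op_norm_sq_le:
  assumes "selfadjoint_op T" and "positive_op T"
  shows "(norm (blinfun_apply T x))\<^sup>2 \<le> norm T * Re (cinner (blinfun_apply T x) x)"
proof (cases "T x = 0")
  case False
  have pos: "0 \<le> Re (cinner (T y) y)" for y
    using assms positive_op_iff by blast
  have sym: "Re (cinner (T u) v) = Re (cinner (T v) u)" for u v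
    by (metis Re_cinner_commute assms(1) selfadjoint_opD)
  have "(Re (cinner (T x) (T x)))\<^sup>2 \<le> Re (cinner (T x) x) * Re (cinner (T (T x)) (T x))"
    by (rule psd_form_Cauchy_Schwarz[of "\<lambda>u v. Re (cinner (T u) v)", OF _ _ sym pos])
      (simp_all add: blinfun.add_right blinfun.scaleR_right cinner_add_left cinner_scaleR_left)
  also have "\<dots> \<le> Re (cinner (T x) x) * (norm T * (norm (T x))\<^sup>2)"
    using Re_cinner_apply_le[of T "T x"] pos[of x] by (intro mult_left_mono) auto
  finally have "(norm (T x))\<^sup>2 * (norm (T x))\<^sup>2 \<le> (norm T * Re (cinner (T x) x)) * (norm (T x))\<^sup>2"
    by (simp add: cinner_self power2_eq_square mult_ac)
  then show ?thesis
    by (rule mult_right_le_imp_le) (use False in simp)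
qed (simp add: cinner.zero_left)

text \<open>Polarization expresses \<open>Re (cinner (T x) y)\<close> by the quadratic form at
  \<open>x + y\<close> and \<open>x - y\<close>, and the parallelogram law adds up the two
  bounds.\<close>

lemma selfadjoint_op_norm_le:
  assumes T: "selfadjoint_op T" and "0 \<le> e"
    and bound: "\<And>x. \<bar>Re (cinner (blinfun_apply T x) x)\<bar> \<le> e * (norm x)\<^sup>2"
  shows "norm T \<le> e"
proof (rule norm_blinfun_bound)
  fix x
  show "norm (T x) \<le> e * norm x"
  proof (cases "T x = 0 \<or> x = 0")
    case False
    have parallelogram: "(norm (u + v))\<^sup>2 + (norm (u - v))\<^sup>2 = 2 * (norm u)\<^sup>2 + 2 * (norm v)\<^sup>2" for u v :: 'a
    proof -
      have "cinner (u + v) (u + v) + cinner (u - v) (u - v) = 2 * cinner u u + 2 * cinner v v"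
        by (simp add: cinner_add_left cinner_add_right cinner.diff_left cinner.diff_right)
      then have "Re (cinner (u + v) (u + v) + cinner (u - v) (u - v)) = Re (2 * cinner u u + 2 * cinner v v)"
        by simp
      then show ?thesis
        by (simp add: cinner_self)
    qed
    \<comment> \<open>The direction of \<open>T x\<close> makes \<open>cinner (T x) y\<close> equal
      to \<open>norm (T x) * norm x\<close>; the length of \<open>x\<close> keeps the right-hand
      side of the parallelogram law in terms of \<open>norm x\<close> alone.\<close>
    define y where "y = (norm x / norm (T x)) *\<^sub>R T x"
    have norm_y: "norm y = norm x"
      using False by (simp add: y_def)
    have "4 * (norm (T x) * norm x) = 4 * Re (cinner (T x) y)"
      using False by (simp add: y_def cinner_scaleR_right cinner_self power2_eq_square)
    also have "\<dots> = Re (cinner (T (x + y)) (x + y)) - Re (cinner (T (x - y)) (x - y))"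
      using Re_cinner_commute[of "T y" x]
      by (simp add: blinfun.add_right blinfun.diff_right cinner_add_left cinner_add_right
          cinner.diff_left cinner.diff_right selfadjoint_opD[OF T, of x y])
    also have "\<dots> \<le> e * (norm (x + y))\<^sup>2 + e * (norm (x - y))\<^sup>2"
      using bound[of "x + y"] bound[of "x - y"] by linarith
    also have "\<dots> = 4 * (e * norm x * norm x)"
      using parallelogram[of x y]
      by (simp add: norm_y power2_eq_square flip: distrib_left)
    finally show ?thesis
      using False by simp
  qed (use \<open>0 \<le> e\<close> in auto)
qed fact

section \<open>The spectrum of a positive operator\<close>

lemma norm_funpow_compose_le:
  fixes T :: "'h::real_normed_vector \<Rightarrow>\<^sub>L 'h"
  shows "norm ((((o\<^sub>L) T) ^^ i) id_blinfun) \<le> norm T ^ i"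
proof (induction i)
  case (Suc i)
  have "norm (T o\<^sub>L (((o\<^sub>L) T) ^^ i) id_blinfun) \<le> norm T * norm ((((o\<^sub>L) T) ^^ i) id_blinfun)"
    by (rule norm_blinfun_compose)
  also have "\<dots> \<le> norm T * norm T ^ i"
    by (intro mult_left_mono Suc norm_ge_zero)
  finally show ?case
    by simp
qed (simp add: norm_blinfun_id_le)

text \<open>The inverse is the sum of the powers of \<open>N\<close>: composing the series with
  \<open>N\<close> on either side only drops its head.\<close>

lemma Neumann_inverse:
  fixes N :: "'h::complex_hilbert_space \<Rightarrow>\<^sub>L 'h"
  assumes N: "N \<in> bounded_ops" and "norm N < 1"
  obtains S where "S \<in> bounded_ops" "S o\<^sub>L (id_blinfun - N) = id_blinfun"
    "(id_blinfun - N) o\<^sub>L S = id_blinfun"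
proof
  define P where "P i = (((o\<^sub>L) N) ^^ i) id_blinfun" for i
  have P0: "P 0 = id_blinfun" and PS: "P (Suc i) = N o\<^sub>L P i" for i
    by (simp_all add: P_def)
  \<comment> \<open>\<open>PS\<close> splits off \<open>N\<close> on the left; splitting it off on
    the right is what the left inverse requires.\<close>
  have PS': "P (Suc i) = P i o\<^sub>L N" for i
    unfolding P_def
    by (rule blinfun_eqI, subst funpow_compose_apply)
      (simp add: funpow_compose_apply funpow_swap1)
  have sumP: "summable P"
    by (rule summable_comparison_test'[where g = "\<lambda>i. norm N ^ i" and N = 0])
      (use assms in \<open>simp_all add: P_def norm_funpow_compose_le\<close>)
  have head: "(\<Sum>i. P (Suc i)) = suminf P - id_blinfun"
    using suminf_split_head[OF sumP] by (simp add: P0)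
  have "(\<lambda>n. \<Sum>i<n. P i) \<longlonglongrightarrow> suminf P"
    by (rule summable_LIMSEQ[OF sumP])
  then show "suminf P \<in> bounded_ops"
    by (rule bounded_ops_limit[rotated]) (auto simp: P_def intro!: bounded_ops_sum bounded_ops_funpow N)
  have "N o\<^sub>L suminf P = (\<Sum>i. P (Suc i))"
    unfolding PS by (rule bounded_linear.suminf[OF blinfun_compose.bounded_linear_right sumP])
  then show "(id_blinfun - N) o\<^sub>L suminf P = id_blinfun"
    by (simp add: blinfun_compose.diff_left head)
  have "suminf P o\<^sub>L N = (\<Sum>i. P (Suc i))"
    unfolding PS' by (rule bounded_linear.suminf[OF blinfun_compose.bounded_linear_left sumP])
  then show "suminf P o\<^sub>L (id_blinfun - N) = id_blinfun"
    by (simp add: blinfun_compose.diff_right head)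
qed

lemma not_in_spectrum_Neumann:
  assumes "N \<in> bounded_ops" and "norm N < 1" and "c \<noteq> 0"
    and eq: "T - op_scaleC z id_blinfun = c *\<^sub>R (id_blinfun - N)"
  shows "z \<notin> spectrum T"
proof -
  obtain S where S: "S \<in> bounded_ops" "S o\<^sub>L (id_blinfun - N) = id_blinfun"
    "(id_blinfun - N) o\<^sub>L S = id_blinfun"
    using Neumann_inverse assms(1,2) by blast
  then have "(1 / c) *\<^sub>R S \<in> bounded_ops"
    "(1 / c) *\<^sub>R S o\<^sub>L (T - op_scaleC z id_blinfun) = id_blinfun"
    "(T - op_scaleC z id_blinfun) o\<^sub>L (1 / c) *\<^sub>R S = id_blinfun"
    using \<open>c \<noteq> 0\<close> unfolding eq
    by (simp_all add: bounded_ops_scaleR blinfun_compose.scaleR_left blinfun_compose.scaleR_right)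
  then show ?thesis
    by (auto simp: spectrum_def)
qed

text \<open>Provides a compact interval inside the domain of \<open>f\<close> on which polynomials
  can approximate it. For \<open>t\<close> on either side of the interval, \<open>T - t\<close> is a
  nonzero multiple of \<open>id_blinfun - N\<close> with \<open>norm N < 1\<close>.\<close>

lemma positive_op_spectrum:
  assumes T: "selfadjoint_op T" and "positive_op T" and t: "complex_of_real t \<in> spectrum T"
  shows "t \<in> {0..norm T}"
proof -
  have "0 \<le> t"
  proof (rule ccontr)
    assume "\<not> 0 \<le> t"
    \<comment> \<open>With this \<open>M\<close> the operator \<open>N\<close> below is
      \<open>(norm T - T) / M\<close>. Its quadratic form on unit vectors lies between 0 and
      \<open>norm T / M\<close>, which is below 1 because \<open>t < 0\<close>.\<close>
    define M where "M = norm T - t"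
    have M: "0 < M"
      using \<open>\<not> 0 \<le> t\<close> norm_ge_zero[of T] unfolding M_def by linarith
    define N where "N = id_blinfun - (1 / M) *\<^sub>R (T - t *\<^sub>R id_blinfun)"
    have N: "selfadjoint_op N"
      unfolding N_def by (intro selfadjoint_op_diff selfadjoint_op_scaleR selfadjoint_op_id T)
    have "norm N \<le> norm T / M"
    proof (rule selfadjoint_op_norm_le[OF N])
      fix x
      have "Re (cinner (N x) x) = (norm x)\<^sup>2 - (Re (cinner (T x) x) - t * (norm x)\<^sup>2) / M"
        by (simp add: N_def blinfun.diff_left blinfun.scaleR_left cinner.diff_left cinner_scaleR_left
            cinner_self)
      also have "\<dots> = (norm T * (norm x)\<^sup>2 - Re (cinner (T x) x)) / M"
        using M by (simp add: field_simps) (simp add: M_def algebra_simps)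
      finally have *: "Re (cinner (N x) x) = (norm T * (norm x)\<^sup>2 - Re (cinner (T x) x)) / M" .
      have "0 \<le> Re (cinner (T x) x)"
        using assms positive_op_iff by blast
      then show "\<bar>Re (cinner (N x) x)\<bar> \<le> norm T / M * (norm x)\<^sup>2"
        unfolding * using Re_cinner_apply_le[of T x] M by (simp add: divide_right_mono)
    qed (use M in simp)
    also have "\<dots> < 1"
      using M \<open>\<not> 0 \<le> t\<close> by (simp add: M_def)
    finally have "complex_of_real t \<notin> spectrum T"
      using M by (intro not_in_spectrum_Neumann[where N = N and c = M])
        (simp_all add: selfadjoint_op_bounded[OF N], simp add: N_def)
    then show False
      using t by simp
  qed
  moreover have "t \<le> norm T"
  proof (rule ccontr)
    assume "\<not> t \<le> norm T"
    then have t': "norm T < t" "0 < t"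
      using norm_ge_zero[of T] by linarith+
    then have "complex_of_real t \<notin> spectrum T"
      by (intro not_in_spectrum_Neumann[where N = "(1 / t) *\<^sub>R T" and c = "- t"])
        (simp_all add: bounded_ops_scaleR selfadjoint_op_bounded[OF T] scaleR_diff_right)
    then show False
      using t by simp
  qed
  ultimately show ?thesis
    by simp
qed

section \<open>Polynomials of self-adjoint operators\<close>

lemma poly_op_altdef:
  assumes "degree p \<le> n"
  shows "poly_op p T = (\<Sum>i\<le>n. coeff p i *\<^sub>R (((o\<^sub>L) T) ^^ i) id_blinfun)"
  unfolding poly_op_def
  by (rule sum.mono_neutral_left) (use assms in \<open>auto simp: coeff_eq_0\<close>)

lemma poly_op_add: "poly_op (p + q) T = poly_op p T + poly_op q T"
proof -
  let ?n = "max (degree p) (degree q)"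
  show ?thesis
    using degree_add_le_max[of p q]
    by (simp add: poly_op_altdef[of _ ?n] scaleR_left_distrib sum.distrib)
qed

lemma poly_op_diff: "poly_op (p - q) T = poly_op p T - poly_op q T"
  using poly_op_add[of "p - q" q T] by simp

lemma poly_op_linear: "poly_op [:a, b:] T = a *\<^sub>R id_blinfun + b *\<^sub>R T"
  by (simp add: poly_op_altdef[of _ 1])

lemma selfadjoint_op_poly_op: "selfadjoint_op T \<Longrightarrow> selfadjoint_op (poly_op p T)"
  unfolding poly_op_def
  by (intro selfadjoint_op_sum selfadjoint_op_scaleR selfadjoint_op_funpow)

text \<open>Coefficients are complex because a real polynomial need not split into linear factors
  over the reals. The result is a vector rather than an operator, as it serves only for lower bounds
  on norms.\<close>

definition cpoly_apply ::
    "complex poly \<Rightarrow> ('h::complex_hilbert_space \<Rightarrow>\<^sub>L 'h) \<Rightarrow> 'h \<Rightarrow> 'h" where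
  "cpoly_apply q T x = (\<Sum>i\<le>degree q. coeff q i *\<^sub>C (blinfun_apply T ^^ i) x)"

lemma cpoly_apply_altdef:
  assumes "degree q \<le> n"
  shows "cpoly_apply q T x = (\<Sum>i\<le>n. coeff q i *\<^sub>C (blinfun_apply T ^^ i) x)"
  unfolding cpoly_apply_def
  by (rule sum.mono_neutral_left) (use assms in \<open>auto simp: coeff_eq_0 scaleC.zero_left\<close>)

lemma cpoly_apply_map_poly:
  "cpoly_apply (map_poly complex_of_real p) T x = blinfun_apply (poly_op p T) x"
  by (simp add: cpoly_apply_altdef[of _ "degree p"] degree_map_poly poly_op_def blinfun.sum_left
      blinfun.scaleR_left funpow_compose_apply coeff_map_poly scaleR_scaleC)

lemma cpoly_apply_linear_factor:
  assumes "T \<in> bounded_ops"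
  shows "cpoly_apply ([:- z, 1:] * q) T x = blinfun_apply T (cpoly_apply q T x) - z *\<^sub>C cpoly_apply q T x"
proof -
  let ?n = "degree q"
  have "degree ([:- z, 1:] * q) \<le> Suc ?n"
    using degree_mult_le[of "[:- z, 1:]" q] by simp
  \<comment> \<open>Summing up to \<open>Suc ?n\<close> makes room for the top coefficient of the
    shifted polynomial \<open>pCons 0 q\<close>.\<close>
  then have "cpoly_apply ([:- z, 1:] * q) T x
      = (\<Sum>i\<le>Suc ?n. coeff (pCons 0 q) i *\<^sub>C (blinfun_apply T ^^ i) x)
        - (\<Sum>i\<le>Suc ?n. (z * coeff q i) *\<^sub>C (blinfun_apply T ^^ i) x)"
    by (simp add: cpoly_apply_altdef[of _ "Suc ?n"] flip: sum_subtractf scaleC.diff_left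
        del: sum.atMost_Suc)
  also have "(\<Sum>i\<le>Suc ?n. coeff (pCons 0 q) i *\<^sub>C (blinfun_apply T ^^ i) x)
      = T (cpoly_apply q T x)"
    by (simp add: sum.atMost_Suc_shift scaleC.zero_left cpoly_apply_def blinfun.sum_right
        bounded_ops_scaleC[OF assms] del: sum.atMost_Suc)
  also have "(\<Sum>i\<le>Suc ?n. (z * coeff q i) *\<^sub>C (blinfun_apply T ^^ i) x) = z *\<^sub>C cpoly_apply q T x"
    by (simp add: cpoly_apply_altdef[of q "Suc ?n"] scaleC.sum_right scaleC_scaleC del: sum.atMost_Suc)
  finally show ?thesis .
qed

text \<open>Over the complex numbers \<open>q\<close> splits into linear factors, which act one
  after the other, so that their lower bounds multiply.\<close>

lemma cpoly_apply_bounded_below: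
  assumes T: "T \<in> bounded_ops" and "q \<noteq> 0"
    and "\<And>z. poly q z = 0 \<Longrightarrow> \<exists>c>0. \<forall>x. c * norm x \<le> norm (blinfun_apply T x - z *\<^sub>C x)"
  shows "\<exists>c>0. \<forall>x. c * norm x \<le> norm (cpoly_apply q T x)"
  using assms(2,3)
proof (induction "degree q" arbitrary: q)
  case 0
  then have "cpoly_apply q T x = coeff q 0 *\<^sub>C x" for x
    by (simp add: cpoly_apply_def)
  moreover have "coeff q 0 \<noteq> 0"
    using 0 by (metis leading_coeff_neq_0)
  ultimately show ?case
    by (intro exI[of _ "cmod (coeff q 0)"]) (simp add: norm_scaleC)
next
  case (Suc n)
  obtain z where z: "poly q z = 0"
    using alg_closed_imp_poly_has_root[of q] Suc.hyps(2) by auto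
  then obtain q' where q: "q = [:- z, 1:] * q'"
    by (auto simp: poly_eq_0_iff_dvd)
  have "q' \<noteq> 0"
    using Suc.prems(1) q by auto
  moreover from this have "n = degree q'"
    using Suc.hyps(2) by (simp add: q degree_mult_eq del: mult_pCons_left)
  moreover have "\<exists>c>0. \<forall>x. c * norm x \<le> norm (T x - w *\<^sub>C x)" if "poly q' w = 0" for w
    using that by (intro Suc.prems(2)) (simp add: q)
  ultimately obtain c' where c': "c' > 0" "\<And>x. c' * norm x \<le> norm (cpoly_apply q' T x)"
    using Suc.hyps(1) by blast
  obtain c where c: "c > 0" "\<And>x. c * norm x \<le> norm (T x - z *\<^sub>C x)"
    using Suc.prems(2) z by blast
  have "(c * c') * norm x \<le> norm (cpoly_apply q T x)" for x
  proof -
    have "c * (c' * norm x) \<le> c * norm (cpoly_apply q' T x)"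
      using c c' by (intro mult_left_mono) auto
    also have "\<dots> \<le> norm (cpoly_apply q T x)"
      unfolding q cpoly_apply_linear_factor[OF T] by (rule c)
    finally show ?thesis
      by (simp add: mult.assoc)
  qed
  then show ?case
    using c(1) c'(1) by (meson mult_pos_pos)
qed

text \<open>For real \<open>z\<close> the bound comes from the inverse. For nonreal
  \<open>z\<close>, the quadratic form of \<open>T\<close> is real, so only \<open>z\<close>
  contributes to the imaginary part of \<open>cinner (T x - z *\<^sub>C x) x\<close>.\<close>

lemma selfadjoint_op_bounded_below:
  assumes T: "selfadjoint_op T" and z: "Im z = 0 \<Longrightarrow> z \<notin> spectrum T"
  shows "\<exists>c>0. \<forall>x. c * norm x \<le> norm (blinfun_apply T x - z *\<^sub>C x)"
proof (cases "Im z = 0")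
  case True
  then obtain S where S: "S o\<^sub>L (T - op_scaleC z id_blinfun) = id_blinfun"
    using z by (auto simp: spectrum_def)
  \<comment> \<open>The summand 1 keeps the factor positive even if \<open>S = 0\<close>, as on the
    zero space.\<close>
  have "norm x \<le> (norm S + 1) * norm (T x - z *\<^sub>C x)" for x
  proof -
    have "x = S (T x - z *\<^sub>C x)"
      using arg_cong[OF S, of "\<lambda>U. blinfun_apply U x"] by (simp add: blinfun.diff_left op_scaleC.rep_eq)
    then have "norm x \<le> norm S * norm (T x - z *\<^sub>C x)"
      by (metis norm_blinfun)
    also have "\<dots> \<le> (norm S + 1) * norm (T x - z *\<^sub>C x)"
      by (intro mult_right_mono) auto
    finally show ?thesis .
  qed
  moreover have "0 < norm S + 1"
    using norm_ge_zero[of S] by linarith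
  ultimately show ?thesis
    by (intro exI[of _ "1 / (norm S + 1)"]) (simp add: field_simps)
next
  case False
  have "\<bar>Im z\<bar> * norm x \<le> norm (T x - z *\<^sub>C x)" for x
  proof (cases "x = 0")
    case False
    have "\<bar>Im z\<bar> * norm x * norm x = \<bar>Im (cinner (T x - z *\<^sub>C x) x)\<bar>"
      by (simp add: cinner.diff_left cinner_scaleC_left cinner_self selfadjoint_op_Im[OF T]
          abs_mult power2_eq_square)
    also have "\<dots> \<le> norm (T x - z *\<^sub>C x) * norm x"
      using abs_Im_le_cmod cmod_cinner_le order_trans by blast
    finally show ?thesis
      using False by simp
  qed simp
  then show ?thesis
    using False by (intro exI[of _ "\<bar>Im z\<bar>"]) simp
qed

lemma poly_map_poly_of_real:
  "poly (map_poly complex_of_real p) (complex_of_real t) = complex_of_real (poly p t)"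
  by (induction p) (simp_all add: map_poly_pCons)

text \<open>Nonconstancy makes \<open>p - m\<close> a nonzero polynomial whatever the infimum
  \<open>m\<close> is, so that it can be factored.\<close>

lemma poly_op_nonneg_nonconstant:
  assumes T: "selfadjoint_op T" and p: "\<And>t. complex_of_real t \<in> spectrum T \<Longrightarrow> 0 \<le> poly p t"
    and deg: "degree p > 0"
  shows "0 \<le> Re (cinner (blinfun_apply (poly_op p T) x) x)"
proof (rule ccontr)
  let ?B = "poly_op p T"
  assume neg: "\<not> ?thesis"
  define R where "R = (\<lambda>x. Re (cinner (?B x) x)) ` {x. norm x = 1}"
  define m where "m = Inf R"
  have homog: "Re (cinner (?B (r *\<^sub>R x)) (r *\<^sub>R x)) = r\<^sup>2 * Re (cinner (?B x) x)" for r x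
    by (simp add: blinfun.scaleR_right cinner_scaleR_left cinner_scaleR_right power2_eq_square)
  \<comment> \<open>Hence \<open>x\<close> can be scaled to the unit sphere. Scaling keeps the sign
    of the form, so the infimum \<open>m\<close> is negative.\<close>
  have "x \<noteq> 0"
    using neg by (auto simp: cinner.zero_left cinner.zero_right)
  then have x_R: "Re (cinner (?B ((1 / norm x) *\<^sub>R x)) ((1 / norm x) *\<^sub>R x)) \<in> R"
    by (auto simp: R_def)
  have bdd: "bdd_below R"
  proof (rule bdd_belowI)
    fix r assume "r \<in> R"
    then obtain y where "norm y = 1" "r = Re (cinner (?B y) y)"
      by (auto simp: R_def)
    then show "- norm ?B \<le> r"
      using Re_cinner_apply_le[of ?B y] by simp
  qed
  have "m \<le> (1 / norm x)\<^sup>2 * Re (cinner (?B x) x)"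
    unfolding m_def using cInf_lower[OF x_R bdd] by (simp only: homog)
  also have "\<dots> < 0"
    using neg \<open>x \<noteq> 0\<close> by (intro mult_pos_neg) auto
  finally have m: "m < 0" .
  define C where "C = ?B - m *\<^sub>R id_blinfun"
  have C: "selfadjoint_op C"
    unfolding C_def by (intro selfadjoint_op_diff selfadjoint_op_scaleR selfadjoint_op_id
        selfadjoint_op_poly_op T)
  have quad: "Re (cinner (C y) y) = Re (cinner (?B y) y) - m * (norm y)\<^sup>2" for y
    by (simp add: C_def blinfun.diff_left blinfun.scaleR_left cinner.diff_left cinner_scaleR_left
        cinner_self)
  have "0 \<le> Re (cinner (C y) y)" for y
  proof (cases "y = 0")
    case False
    then have "Re (cinner (?B ((1 / norm y) *\<^sub>R y)) ((1 / norm y) *\<^sub>R y)) \<in> R"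
      by (auto simp: R_def)
    from cInf_lower[OF this bdd] have "m \<le> (1 / norm y)\<^sup>2 * Re (cinner (?B y) y)"
      by (simp only: homog m_def)
    then show ?thesis
      using False by (simp add: quad power2_eq_square field_simps)
  qed (simp add: cinner.zero_left)
  then have C_pos: "positive_op C"
    using C by (simp add: positive_op_iff)
  let ?q = "map_poly complex_of_real (p - [:m:])"
  have C_eq: "C y = cpoly_apply ?q T y" for y
    using poly_op_linear[of m 0 T] by (simp add: cpoly_apply_map_poly poly_op_diff C_def)
  have "p \<noteq> [:m:]"
    using deg by auto
  then have "?q \<noteq> 0"
    by (simp add: map_poly_eq_0_iff)
  have "\<exists>c>0. \<forall>y. c * norm y \<le> norm (C y)"
    unfolding C_eq
  proof (rule cpoly_apply_bounded_below[OF selfadjoint_op_bounded[OF T] \<open>?q \<noteq> 0\<close>])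
    fix z assume root: "poly ?q z = 0"
    show "\<exists>c>0. \<forall>x. c * norm x \<le> norm (T x - z *\<^sub>C x)"
    proof (rule selfadjoint_op_bounded_below[OF T])
      \<comment> \<open>At a real root \<open>p\<close> takes the value \<open>m < 0\<close>, so by
        hypothesis the root lies outside the spectrum.\<close>
      assume "Im z = 0"
      then have z: "z = complex_of_real (Re z)"
        by (simp add: complex_eq_iff)
      then have "poly ?q z = complex_of_real (poly p (Re z) - m)"
        by (metis poly_map_poly_of_real poly_diff poly_pCons mult_zero_right add_0_right poly_0)
      then have "poly p (Re z) < 0"
        using root m by (simp flip: of_real_diff)
      then show "z \<notin> spectrum T"
        using p[of "Re z"] z by force
    qed
  qed
  then obtain c where c: "c > 0" "\<And>y. c * norm y \<le> norm (C y)"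
    by blast
  \<comment> \<open>On unit vectors the square of \<open>c\<close> is at most \<open>norm C\<close>
    times the form of \<open>C\<close>. So the form of \<open>C\<close> is at least
    \<open>d\<close>, and that of \<open>?B\<close> at least \<open>m + d\<close>; the summand 1
    avoids division by zero.\<close>
  define d where "d = c\<^sup>2 / (norm C + 1)"
  have C1: "0 < norm C + 1"
    using norm_ge_zero[of C] by linarith
  have "m + d \<le> Inf R"
  proof (rule cInf_greatest)
    show "R \<noteq> {}"
      using x_R by blast
    fix r assume "r \<in> R"
    then obtain y where y: "norm y = 1" "r = Re (cinner (?B y) y)"
      by (auto simp: R_def)
    have "c\<^sup>2 \<le> (norm (C y))\<^sup>2"
      using c(2)[of y] c(1) y(1) by (intro power_mono) auto
    also have "\<dots> \<le> norm C * Re (cinner (C y) y)"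
      by (rule positive_op_norm_sq_le[OF C C_pos])
    also have "\<dots> \<le> (norm C + 1) * Re (cinner (C y) y)"
      using C_pos C by (intro mult_right_mono) (auto simp: positive_op_iff)
    finally show "m + d \<le> r"
      using C1 by (simp add: quad y d_def field_simps)
  qed
  moreover have "0 < d"
    using c(1) C1 by (simp add: d_def)
  ultimately show False
    by (simp add: m_def)
qed

text \<open>The sign of a constant polynomial can be read off only at a real point of the spectrum,
  so a constant \<open>p\<close> calls for a separate look at whether such a point exists.\<close>

lemma poly_op_nonneg:
  assumes T: "selfadjoint_op T" and p: "\<And>t. complex_of_real t \<in> spectrum T \<Longrightarrow> 0 \<le> poly p t"
  shows "0 \<le> Re (cinner (blinfun_apply (poly_op p T) x) x)"
proof (cases "degree p > 0")
  case True
  then show ?thesis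
    using poly_op_nonneg_nonconstant[OF T p] by simp
next
  case False
  then obtain a where a: "p = [:a:]"
    using degree_eq_zeroE by blast
  then have eq: "Re (cinner (poly_op p T x) x) = a * (norm x)\<^sup>2"
    using poly_op_linear[of a 0 T] by (simp add: blinfun.scaleR_left cinner_scaleR_left cinner_self)
  show ?thesis
  proof (cases "\<exists>t. complex_of_real t \<in> spectrum T")
    case True
    then have "0 \<le> a"
      using p a by auto
    then show ?thesis
      by (simp add: eq)
  next
    case False
    \<comment> \<open>Only the zero space has this: with no real spectrum every nonconstant polynomial gives a
      positive operator, in particular \<open>t - (norm T + 1)\<close>.\<close>
    have "0 \<le> Re (cinner (poly_op [:- (norm T + 1), 1:] T x) x)"
      by (rule poly_op_nonneg_nonconstant[OF T]) (use False in auto)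
    also have "\<dots> = Re (cinner (T x) x) - (norm T + 1) * (norm x)\<^sup>2"
      by (simp add: poly_op_linear left_diff_distrib distrib_right blinfun.add_left blinfun.scaleR_left blinfun.diff_left
          blinfun.minus_left cinner_add_left cinner.diff_left cinner.minus_left cinner_scaleR_left cinner_self)
    also have "\<dots> \<le> - (norm x)\<^sup>2"
      using Re_cinner_apply_le[of T x] by (simp add: algebra_simps)
    finally have "x = 0"
      by simp
    then show ?thesis
      by (simp add: cinner.zero_right)
  qed
qed

text \<open>Both \<open>e - p\<close> and \<open>e + p\<close> are nonnegative on the spectrum,
  which bounds the quadratic form and with it the norm. This estimate carries uniform convergence on
  the spectrum over to the operator norm.\<close>

lemma norm_poly_op_le:
  assumes T: "selfadjoint_op T" and "0 \<le> e"
    and p: "\<And>t. complex_of_real t \<in> spectrum T \<Longrightarrow> \<bar>poly p t\<bar> \<le> e"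
  shows "norm (poly_op p T) \<le> e"
proof (rule selfadjoint_op_norm_le[OF selfadjoint_op_poly_op[OF T] \<open>0 \<le> e\<close>])
  fix x
  have const: "Re (cinner (poly_op [:e:] T x) x) = e * (norm x)\<^sup>2"
    using poly_op_linear[of e 0 T] by (simp add: blinfun.scaleR_left cinner_scaleR_left cinner_self)
  have "0 \<le> Re (cinner (poly_op ([:e:] - p) T x) x)"
    by (rule poly_op_nonneg[OF T]) (use p in force)
  moreover have "0 \<le> Re (cinner (poly_op ([:e:] + p) T x) x)"
    by (rule poly_op_nonneg[OF T]) (use p in force)
  ultimately show "\<bar>Re (cinner (poly_op p T x) x)\<bar> \<le> e * (norm x)\<^sup>2"
    by (simp add: poly_op_diff poly_op_add blinfun.diff_left blinfun.add_left cinner.diff_left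
        cinner_add_left const)
qed

section \<open>The continuous functional calculus\<close>

lemma polynomial_uniform_limit:
  fixes f :: "real \<Rightarrow> real"
  assumes "continuous_on {a..b} f"
  obtains p :: "nat \<Rightarrow> real poly" where "uniform_limit {a..b} (\<lambda>n. poly (p n)) f sequentially"
proof -
  have "\<exists>q :: real poly. \<forall>x\<in>{a..b}. \<bar>f x - poly q x\<bar> < inverse (real (Suc n))" for n
  proof -
    obtain g where g: "real_polynomial_function g"
      "\<And>x. x \<in> {a..b} \<Longrightarrow> \<bar>f x - g x\<bar> < inverse (real (Suc n))"
      using Stone_Weierstrass_real_polynomial_function[OF compact_Icc assms, of "inverse (real (Suc n))"]
      by auto
    then obtain c k where "g = (\<lambda>x. \<Sum>i\<le>k. c i * x ^ i)"
      unfolding real_polynomial_function_iff_sum by blast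
    then have "g = poly (\<Sum>i\<le>k. monom (c i) i)"
      by (simp add: poly_sum poly_monom fun_eq_iff)
    then show ?thesis
      using g(2) by blast
  qed
  then obtain p :: "nat \<Rightarrow> real poly"
    where p: "\<And>n x. x \<in> {a..b} \<Longrightarrow> \<bar>f x - poly (p n) x\<bar> < inverse (real (Suc n))"
    by metis
  have "uniform_limit {a..b} (\<lambda>n. poly (p n)) f sequentially"
  proof (rule uniform_limitI)
    fix e :: real assume "0 < e"
    then have "\<forall>\<^sub>F n in sequentially. inverse (real (Suc n)) < e"
      by (rule order_tendstoD[OF LIMSEQ_inverse_real_of_nat])
    then show "\<forall>\<^sub>F n in sequentially. \<forall>x\<in>{a..b}. dist (poly (p n) x) (f x) < e"
    proof eventually_elim
      case (elim n)
      show ?case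
      proof
        fix x assume "x \<in> {a..b}"
        then show "dist (poly (p n) x) (f x) < e"
          using p[of x n] elim by (simp add: dist_real_def abs_minus_commute)
      qed
    qed
  qed
  then show ?thesis
    by (rule that)
qed

lemma poly_op_Cauchy:
  assumes T: "selfadjoint_op T"
    and lim: "uniform_limit {t. complex_of_real t \<in> spectrum T} (\<lambda>n. poly (p n)) f sequentially"
  shows "Cauchy (\<lambda>n. poly_op (p n) T)"
proof (rule CauchyI)
  fix e :: real assume "0 < e"
  \<comment> \<open>Two values within \<open>e / 4\<close> of \<open>f\<close> differ by at most
    \<open>e / 2\<close>, so the non-strict norm estimate still gives a strict bound by
    \<open>e\<close>.\<close>
  then obtain M where M: "\<And>n t. n \<ge> M \<Longrightarrow> complex_of_real t \<in> spectrum T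
      \<Longrightarrow> dist (poly (p n) t) (f t) < e / 4"
    using uniform_limitD[OF lim, of "e / 4"] by (auto simp: eventually_sequentially)
  have "norm (poly_op (p m) T - poly_op (p n) T) < e" if "m \<ge> M" "n \<ge> M" for m n
  proof -
    have "norm (poly_op (p m - p n) T) \<le> e / 2"
    proof (rule norm_poly_op_le[OF T])
      fix t assume "complex_of_real t \<in> spectrum T"
      from M[OF that(1) this] M[OF that(2) this] show "\<bar>poly (p m - p n) t\<bar> \<le> e / 2"
        unfolding dist_real_def poly_diff by linarith
    qed (use \<open>0 < e\<close> in simp)
    then show ?thesis
      using \<open>0 < e\<close> by (simp add: poly_op_diff)
  qed
  then show "\<exists>M. \<forall>m\<ge>M. \<forall>n\<ge>M. norm (poly_op (p m) T - poly_op (p n) T) < e"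
    by blast
qed

text \<open>The uniqueness behind the definite description in \<open>cfc\<close>: the difference of
  the two polynomial sequences tends to 0 uniformly on the spectrum, hence also as
  operators.\<close>

lemma poly_op_limit_unique:
  assumes T: "selfadjoint_op T"
    and p: "uniform_limit {t. complex_of_real t \<in> spectrum T} (\<lambda>n. poly (p n)) f sequentially"
      "(\<lambda>n. poly_op (p n) T) \<longlonglongrightarrow> R"
    and q: "uniform_limit {t. complex_of_real t \<in> spectrum T} (\<lambda>n. poly (q n)) f sequentially"
      "(\<lambda>n. poly_op (q n) T) \<longlonglongrightarrow> S"
  shows "R = S"
proof -
  have "(\<lambda>n. poly_op (p n - q n) T) \<longlonglongrightarrow> 0"
  proof (rule tendstoI)
    fix e :: real assume "0 < e"
    then have "0 < e / 4"
      by simp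
    from uniform_limitD[OF p(1) this] uniform_limitD[OF q(1) this]
    show "\<forall>\<^sub>F n in sequentially. dist (poly_op (p n - q n) T) 0 < e"
    proof eventually_elim
      case (elim n)
      have "norm (poly_op (p n - q n) T) \<le> e / 2"
      proof (rule norm_poly_op_le[OF T])
        fix t assume "complex_of_real t \<in> spectrum T"
        then have "dist (poly (p n) t) (f t) < e / 4" "dist (poly (q n) t) (f t) < e / 4"
          using elim by auto
        then show "\<bar>poly (p n - q n) t\<bar> \<le> e / 2"
          unfolding dist_real_def poly_diff by linarith
      qed (use \<open>0 < e\<close> in simp)
      then show ?case
        using \<open>0 < e\<close> by simp
    qed
  qed
  moreover have "(\<lambda>n. poly_op (p n - q n) T) \<longlonglongrightarrow> R - S"
    unfolding poly_op_diff by (intro tendsto_diff p q)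
  ultimately show ?thesis
    using LIMSEQ_unique by fastforce
qed

text \<open>Unfolds the definite description once and for all; later facts about \<open>cfc\<close>
  are limits along these polynomials.\<close>

lemma cfc_approximation:
  assumes T: "selfadjoint_op T" "positive_op T" and f: "continuous_on {0..} f"
  obtains p :: "nat \<Rightarrow> real poly"
  where "uniform_limit {t. complex_of_real t \<in> spectrum T} (\<lambda>n. poly (p n)) f sequentially"
    "(\<lambda>n. poly_op (p n) T) \<longlonglongrightarrow> cfc f T"
proof -
  have "continuous_on {0..norm T} f"
    using f by (rule continuous_on_subset) simp
  then obtain p :: "nat \<Rightarrow> real poly" where "uniform_limit {0..norm T} (\<lambda>n. poly (p n)) f sequentially"
    using polynomial_uniform_limit by blast
  then have p: "uniform_limit {t. complex_of_real t \<in> spectrum T} (\<lambda>n. poly (p n)) f sequentially"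
    by (rule uniform_limit_on_subset) (use positive_op_spectrum[OF T] in blast)
  obtain S where S: "(\<lambda>n. poly_op (p n) T) \<longlonglongrightarrow> S"
    using poly_op_Cauchy[OF T(1) p] Cauchy_convergent convergent_def by blast
  have "cfc f T = S"
    unfolding cfc_def by (rule the_equality) (use p S poly_op_limit_unique[OF T(1)] in blast)+
  then show ?thesis
    using that p S by blast
qed

lemma selfadjoint_op_cfc:
  assumes "selfadjoint_op T" "positive_op T" "continuous_on {0..} f"
  shows "selfadjoint_op (cfc f T)"
proof -
  obtain p :: "nat \<Rightarrow> real poly" where "(\<lambda>n. poly_op (p n) T) \<longlonglongrightarrow> cfc f T"
    using cfc_approximation[OF assms] by blast
  then show ?thesis
    by (rule selfadjoint_op_limit[OF selfadjoint_op_poly_op[OF assms(1)]])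
qed

text \<open>The approximating polynomials exceed the affine function up to an error \<open>e\<close>
  on the spectrum, so positivity up to \<open>e\<close> passes to the limit, and then
  \<open>e\<close> tends to 0. Supporting lines are the intended affine functions.\<close>

lemma cfc_ge_affine:
  assumes T: "selfadjoint_op T" "positive_op T" and f: "continuous_on {0..} f"
    and le: "\<And>t. 0 \<le> t \<Longrightarrow> a + b * t \<le> f t"
  shows "positive_op (cfc f T - (a *\<^sub>R id_blinfun + b *\<^sub>R T))"
proof -
  let ?L = "a *\<^sub>R id_blinfun + b *\<^sub>R T"
  obtain p :: "nat \<Rightarrow> real poly"
    where p: "uniform_limit {t. complex_of_real t \<in> spectrum T} (\<lambda>n. poly (p n)) f sequentially"
      "(\<lambda>n. poly_op (p n) T) \<longlonglongrightarrow> cfc f T"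
    using cfc_approximation[OF T f] by blast
  have sa: "selfadjoint_op (cfc f T - ?L)"
    by (intro selfadjoint_op_diff selfadjoint_op_add selfadjoint_op_scaleR selfadjoint_op_id
        selfadjoint_op_cfc T f)
  have "0 \<le> Re (cinner ((cfc f T - ?L) x) x)" for x
  proof -
    have "- e * (norm x)\<^sup>2 \<le> Re (cinner ((cfc f T - ?L) x) x)" if "0 < e" for e
    proof -
      have "(\<lambda>n. Re (cinner ((poly_op (p n) T - ?L) x) x)) \<longlonglongrightarrow> Re (cinner ((cfc f T - ?L) x) x)"
        by (intro tendsto_Re cinner.tendsto blinfun.tendsto tendsto_diff p(2) tendsto_const)
      moreover have "\<forall>\<^sub>F n in sequentially. - e * (norm x)\<^sup>2 \<le> Re (cinner ((poly_op (p n) T - ?L) x) x)"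
        using uniform_limitD[OF p(1) that]
      proof eventually_elim
        case (elim n)
        \<comment> \<open>Lowering the constant term by \<open>e\<close> absorbs the distance
          between \<open>p n\<close> and \<open>f\<close>.\<close>
        have "0 \<le> Re (cinner (poly_op (p n - [:a - e, b:]) T x) x)"
        proof (rule poly_op_nonneg[OF T(1)])
          fix t assume t: "complex_of_real t \<in> spectrum T"
          then have "dist (poly (p n) t) (f t) < e"
            using elim by simp
          moreover have "0 \<le> t"
            using positive_op_spectrum[OF T t] by simp
          then have "a + b * t \<le> f t"
            by (rule le)
          ultimately show "0 \<le> poly (p n - [:a - e, b:]) t"
            unfolding dist_real_def by (simp add: mult.commute[of b])
        qed
        then show ?case
          by (simp add: poly_op_diff poly_op_linear blinfun.diff_left blinfun.add_left
              blinfun.scaleR_left cinner.diff_left cinner_add_left cinner_scaleR_left cinner_self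
              algebra_simps)
      qed
      ultimately show ?thesis
        by (rule tendsto_lowerbound) simp
    qed
    then have "\<forall>\<^sub>F e in at_right 0. - e * (norm x)\<^sup>2 \<le> Re (cinner ((cfc f T - ?L) x) x)"
      by (auto simp: eventually_at_filter)
    moreover have "((\<lambda>e. - e * (norm x)\<^sup>2) \<longlongrightarrow> - 0 * (norm x)\<^sup>2) (at_right 0)"
      by (intro tendsto_intros)
    ultimately have "- 0 * (norm x)\<^sup>2 \<le> Re (cinner ((cfc f T - ?L) x) x)"
      by (intro tendsto_upperbound) auto
    then show ?thesis
      by simp
  qed
  then show ?thesis
    using sa by (simp add: positive_op_iff)
qed

section \<open>Superquadratic functions and Jensen's inequality\<close>

text \<open>At \<open>x = y = 0\<close> superquadraticity reads \<open>f 0 \<ge> 2 * f 0\<close>.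
  The value matters where the normalized kernel is 0.\<close>

lemma superquadratic_nonneg_zero:
  assumes "superquadratic f" and "\<And>t. 0 \<le> t \<Longrightarrow> 0 \<le> f t"
  shows "f 0 = 0"
proof -
  obtain C where "\<forall>y\<ge>0. f y \<ge> f 0 + C * (y - 0) + f \<bar>y - 0\<bar>"
    using assms(1) unfolding superquadratic_def by blast
  from this[rule_format, of 0] show ?thesis
    using assms(2)[of 0] by simp
qed

lemma superquadratic_nonneg_supporting_line:
  assumes "superquadratic f" and "\<And>t. 0 \<le> t \<Longrightarrow> 0 \<le> f t" and "0 \<le> x"
  obtains C where "\<And>y. 0 \<le> y \<Longrightarrow> f x + C * (y - x) \<le> f y"
proof -
  obtain C where C: "\<And>y. 0 \<le> y \<Longrightarrow> f y \<ge> f x + C * (y - x) + f \<bar>y - x\<bar>"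
    using assms(1,3) unfolding superquadratic_def by blast
  show ?thesis
  proof (rule that)
    fix y :: real assume "0 \<le> y"
    then show "f x + C * (y - x) \<le> f y"
      using C[of y] assms(2)[of "\<bar>y - x\<bar>"] by simp
  qed
qed

lemma superquadratic_nonneg_convex:
  assumes "superquadratic f" and "\<And>t. 0 \<le> t \<Longrightarrow> 0 \<le> f t"
  shows "convex_on {0..} f"
proof (rule convex_onI)
  fix t x y :: real
  assume t: "0 < t" "t < 1" and xy: "x \<in> {0..}" "y \<in> {0..}"
  define z where "z = (1 - t) *\<^sub>R x + t *\<^sub>R y"
  have "0 \<le> z"
    using t xy by (simp add: z_def)
  then obtain C where C: "\<And>y. 0 \<le> y \<Longrightarrow> f z + C * (y - z) \<le> f y"
    using superquadratic_nonneg_supporting_line[OF assms] by blast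
  \<comment> \<open>The slope terms cancel because \<open>z\<close> is the weighted mean of
    \<open>x\<close> and \<open>y\<close>.\<close>
  have "f z = (1 - t) * (f z + C * (x - z)) + t * (f z + C * (y - z))"
    by (simp add: z_def algebra_simps)
  also have "\<dots> \<le> (1 - t) * f x + t * f y"
    using t xy C by (intro add_mono mult_left_mono) auto
  finally show "f ((1 - t) *\<^sub>R x + t *\<^sub>R y) \<le> (1 - t) * f x + t * f y"
    by (simp add: z_def)
qed simp

section \<open>Berezin transforms and positive maps\<close>

lemma berezin_transform_positive:
  assumes "positive_op T"
  shows "complex_of_real (Re (berezin_transform ev T x)) = berezin_transform ev T x"
    and "0 \<le> Re (berezin_transform ev T x)"
  using assms
  by (simp_all add: berezin_transform_def positive_op_def complex_nonneg_Reals_iff complex_eq_iff)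

text \<open>Division by zero yields 0, so a vanishing kernel gives the zero vector.\<close>

lemma normalized_kernel_cases:
  "normalized_kernel ev x = 0 \<or> norm (normalized_kernel ev x) = 1"
  by (simp add: normalized_kernel_def)

lemma normalized_positive_linear_map_affine:
  assumes "normalized_positive_linear_map \<Phi>" and "S \<in> bounded_ops" and "T \<in> bounded_ops"
  shows "\<Phi> (S + (a *\<^sub>R id_blinfun + b *\<^sub>R T)) = \<Phi> S + (a *\<^sub>R id_blinfun + b *\<^sub>R \<Phi> T)"
proof -
  have scaleR: "\<Phi> (r *\<^sub>R U) = r *\<^sub>R \<Phi> U" if "U \<in> bounded_ops" for r U
    using assms(1) that unfolding normalized_positive_linear_map_def
    by (metis op_scaleC_of_real)
  show ?thesis
    using assms by (simp add: normalized_positive_linear_map_def bounded_ops_add bounded_ops_scaleR scaleR)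
qed

text \<open>The operator \<open>f(A)\<close> dominates the supporting line evaluated at
  \<open>A\<close>. Applying \<Phi> and then the quadratic form at the unit vector \<open>k\<close>
  turns the line into its value \<open>f s\<close> at the contact point.\<close>

lemma berezin_Jensen:
  assumes A: "selfadjoint_op A" "positive_op A" and \<Phi>: "normalized_positive_linear_map \<Phi>"
    and f: "continuous_on {0..} f" "superquadratic f" "\<And>t. 0 \<le> t \<Longrightarrow> 0 \<le> f t"
  shows "f (Re (berezin_transform ev (\<Phi> A) \<mu>)) \<le> Re (berezin_transform ev (\<Phi> (cfc f A)) \<mu>)"
proof (cases "normalized_kernel ev \<mu> = 0")
  case True
  \<comment> \<open>Both transforms are 0 here, and the claim reduces to
    \<open>f 0 \<le> 0\<close>.\<close>
  then show ?thesis
    using superquadratic_nonneg_zero[OF f(2,3)] by (simp add: berezin_transform_def cinner.zero_right)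
next
  case False
  define k where "k = normalized_kernel ev \<mu>"
  have k: "cinner k k = 1"
    using False normalized_kernel_cases[of ev \<mu>] by (simp add: k_def cinner_self)
  define s where "s = Re (berezin_transform ev (\<Phi> A) \<mu>)"
  have s: "s = Re (cinner (\<Phi> A k) k)"
    by (simp add: s_def k_def berezin_transform_def)
  have pos: "positive_op (\<Phi> T)" if "positive_op T" for T
    using \<Phi> that by (simp add: normalized_positive_linear_map_def)
  have "0 \<le> s"
    unfolding s_def by (rule berezin_transform_positive(2)[OF pos[OF A(2)]])
  then obtain C where C: "\<And>t. 0 \<le> t \<Longrightarrow> f s + C * (t - s) \<le> f t"
    using superquadratic_nonneg_supporting_line[OF f(2,3)] by blast
  \<comment> \<open>The line \<open>f s + C * (t - s)\<close> with \<open>A\<close> in place of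
    \<open>t\<close>, its constant term collected.\<close>
  define L where "L = (f s - C * s) *\<^sub>R id_blinfun + C *\<^sub>R A"
  have D: "positive_op (cfc f A - L)"
    unfolding L_def using C by (intro cfc_ge_affine A f(1)) (simp add: algebra_simps)
  have "\<Phi> (cfc f A) = \<Phi> (cfc f A - L) + ((f s - C * s) *\<^sub>R id_blinfun + C *\<^sub>R \<Phi> A)"
    using normalized_positive_linear_map_affine[OF \<Phi>, of "cfc f A - L" A "f s - C * s" C] D A
    by (simp add: positive_op_def flip: L_def)
  then have "Re (cinner (\<Phi> (cfc f A) k) k) = Re (cinner (\<Phi> (cfc f A - L) k) k) + f s"
    by (simp add: blinfun.add_left blinfun.scaleR_left cinner_add_left cinner_scaleR_left k flip: s)
  moreover have "0 \<le> Re (cinner (\<Phi> (cfc f A - L) k) k)"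
    using pos[OF D] by (simp add: positive_op_def complex_nonneg_Reals_iff)
  ultimately show ?thesis
    by (simp add: berezin_transform_def s_def[symmetric] flip: k_def s)
qed

theorem corollary6p7:
  fixes \<Omega> :: "'a set" and ev\<^sub>H :: "'h::complex_hilbert_space \<Rightarrow> 'a \<Rightarrow> complex"
    and Q :: "'b set" and ev\<^sub>K :: "'k::complex_hilbert_space \<Rightarrow> 'b \<Rightarrow> complex"
    and A :: "'h \<Rightarrow>\<^sub>L 'h"
    and \<Phi> :: "('h \<Rightarrow>\<^sub>L 'h) \<Rightarrow> ('k \<Rightarrow>\<^sub>L 'k)"
    and f :: "real \<Rightarrow> real"
  assumes "rkhs \<Omega> ev\<^sub>H" and "rkhs Q ev\<^sub>K"
    and "positive_op A" and "selfadjoint_op A"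
    and "normalized_positive_linear_map \<Phi>"
    and "continuous_on {0..} f" and "superquadratic f"
    and "\<And>t. t \<ge> 0 \<Longrightarrow> f t \<ge> 0"
    and "\<And>\<mu>. \<mu> \<in> Q \<Longrightarrow>
      f (Re (berezin_transform ev\<^sub>K (\<Phi> A) \<mu>)) \<ge> Re (berezin_transform ev\<^sub>K (\<Phi> (cfc f A)) \<mu>)"
  shows "convex_on {0..} f \<and>
    (\<lambda>z. complex_of_real (f (Re z))) ` berezin_range Q ev\<^sub>K (\<Phi> A)
      = berezin_range Q ev\<^sub>K (\<Phi> (cfc f A))"
proof
  show "convex_on {0..} f"
    using superquadratic_nonneg_convex assms(7,8) by blast
  have \<Phi>: "positive_op (\<Phi> T)" if "positive_op T" for T
    using assms(5) that by (simp add: normalized_positive_linear_map_def)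
  \<comment> \<open>The affine bound is the zero function here.\<close>
  have "positive_op (cfc f A)"
    using cfc_ge_affine[of A f 0 0] assms by simp
  \<comment> \<open>Both sides are real, so the equality of real parts given by Jensen's inequality
    and its assumed reverse is an equality of complex numbers.\<close>
  note real = berezin_transform_positive(1)[OF \<Phi>[OF this], of ev\<^sub>K]
  have "complex_of_real (f (Re (berezin_transform ev\<^sub>K (\<Phi> A) \<mu>)))
      = berezin_transform ev\<^sub>K (\<Phi> (cfc f A)) \<mu>" if "\<mu> \<in> Q" for \<mu>
  proof -
    have "f (Re (berezin_transform ev\<^sub>K (\<Phi> A) \<mu>)) = Re (berezin_transform ev\<^sub>K (\<Phi> (cfc f A)) \<mu>)"
      using berezin_Jensen[OF assms(4,3,5,6,7,8)] assms(9)[OF that] by (rule antisym)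
    then show ?thesis
      by (simp only: real)
  qed
  then show "(\<lambda>z. complex_of_real (f (Re z))) ` berezin_range Q ev\<^sub>K (\<Phi> A)
      = berezin_range Q ev\<^sub>K (\<Phi> (cfc f A))"
    unfolding berezin_range_def setcompr_eq_image image_image Collect_mem_eq by simp
qed

end
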